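(* Let $0<\alpha<\tfrac12$, $0<\tau<1$ and $\xi\in\mathbb{R}$, and define $$T_s:=\frac{\sin\pi(1-\tau+\alpha-i\xi)}{\sin\pi(1-\tau+2\alpha-i\xi)},\qquad T_B:=\frac{\sin\pi\alpha}{\pi}\,B(\tau-2\alpha+1+i\xi,2\alpha).$$ (a) If $\xi=0$ and $0<\tau<1$, then $T_s\ne T_B$. (b) If $\xi\ge\tfrac14$ and $\alpha\le\tau<1$, then $|T_s|>|T_B|$. (c) If $0<\xi<\tfrac14$ and $\alpha\le\tau<1$, then $\arg T_s<\arg T_B$. (d) If $\xi>0$ and $0<\tau<\alpha$, then $\arg T_s\ne\arg T_B$. Consequently, the equation $T_s=T_B$ has no solutions with $0<\alpha<\tfrac12$, $0<\tau<1$, $\xi\in\mathbb{R}$.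
   Context: $B(a,b)=\Gamma(a)\Gamma(b)/\Gamma(a+b)$ is the Beta function extended to complex arguments. $\arg$ denotes the principal argument, with values in $(-\pi,\pi]$. *)

theory Defs
  imports "HOL-Analysis.Analysis"
begin

definition T_s :: "real \<Rightarrow> real \<Rightarrow> real \<Rightarrow> complex" where
  "T_s \<alpha> \<tau> \<xi> =
     sin (of_real pi * (of_real (1 - \<tau> + \<alpha>) - \<i> * of_real \<xi>)) /
     sin (of_real pi * (of_real (1 - \<tau> + 2 * \<alpha>) - \<i> * of_real \<xi>))"

definition T_B :: "real \<Rightarrow> real \<Rightarrow> real \<Rightarrow> complex" where
  "T_B \<alpha> \<tau> \<xi> =
     of_real (sin (pi * \<alpha>) / pi) *
     Beta (of_real (\<tau> - 2 * \<alpha> + 1) + \<i> * of_real \<xi>) (of_real (2 * \<alpha>))"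

end

theory Submission
  imports Defs
begin

text \<open>
  For \<open>\<xi> > 0\<close> the strict inequality \<open>Arg T_s < Arg T_B\<close> holds on the whole range \<open>0 < \<tau> < 1\<close>, which gives
  (c) and (d) at once. By the reflection formula both arguments are combinations of
  \<open>H(t) = Im log \<Gamma>(t + i\<xi>)\<close>. Fixing \<open>u = \<tau> - \<alpha>\<close> and regarding their difference as a function of \<open>\<alpha>\<close>, it
  vanishes at \<open>\<alpha> = 0\<close> and has derivative \<open>F(1 + u + \<alpha>) - F(\<alpha> - u)\<close>, where
  \<open>F(t) = H'(t) = \<Sum>n. \<xi> / ((t + n)\<^sup>2 + \<xi>\<^sup>2)\<close>. This is negative because \<open>F\<close> decreases on \<open>t \<ge> 0\<close> and
  \<open>F(t) > F(t + 1)\<close>.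

  For (b), \<open>|T_B| \<le> 2/\<pi> < tanh (\<pi>/4) \<le> tanh (\<pi>\<xi>) \<le> |T_s|\<close>. For (a), the two real numbers either have
  different signs (\<open>\<alpha> \<le> \<tau> \<le> 2\<alpha>\<close>), or are separated by \<open>1/2\<close> (\<open>2\<alpha> < \<tau>\<close>), or are compared through the
  logarithmic derivative of their quotient (\<open>\<tau> < \<alpha>\<close>).
\<close>

section \<open>The argument of the Gamma function along a horizontal line\<close>

text \<open>Built on \<open>ln_Gamma\<close> instead of \<open>Arg\<close>: for \<xi> \<noteq> 0 the
  horizontal line avoids the branch cut, so this is a smooth branch of the argument of
  \<open>Gamma\<close>.\<close>

definition arg_Gamma :: "real \<Rightarrow> real \<Rightarrow> real" where
  "arg_Gamma \<xi> t = Im (ln_Gamma (Complex t \<xi>))"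

definition Im_Digamma :: "real \<Rightarrow> real \<Rightarrow> real" where
  "Im_Digamma \<xi> t = Im (Digamma (Complex t \<xi>))"

lemma Complex_not_nonpos_Reals: "\<xi> \<noteq> 0 \<Longrightarrow> Complex t \<xi> \<notin> \<real>\<^sub>\<le>\<^sub>0"
  by (simp add: complex_nonpos_Reals_iff)

lemma Complex_not_nonpos_Ints: "\<xi> \<noteq> 0 \<Longrightarrow> Complex t \<xi> \<notin> \<int>\<^sub>\<le>\<^sub>0"
  using Complex_not_nonpos_Reals nonpos_Ints_subset_nonpos_Reals by blast

lemma has_field_derivative_arg_Gamma:
  assumes "\<xi> \<noteq> 0"
  shows "(arg_Gamma \<xi> has_field_derivative Im_Digamma \<xi> t) (at t)"
proof -
  have line: "((\<lambda>t. Complex t \<xi>) has_vector_derivative 1) (at t)"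
  proof -
    have "((\<lambda>t. of_real t + \<i> * of_real \<xi>) has_vector_derivative 1) (at t)"
      by (auto intro!: derivative_eq_intros)
    thus ?thesis by (simp add: Complex_eq)
  qed
  have "((ln_Gamma \<circ> (\<lambda>t. Complex t \<xi>)) has_vector_derivative (1 * Digamma (Complex t \<xi>))) (at t)"
    by (rule field_vector_diff_chain_at[OF line])
       (rule has_field_derivative_ln_Gamma_complex[OF Complex_not_nonpos_Reals[OF assms]])
  hence "((\<lambda>t. Im (ln_Gamma (Complex t \<xi>))) has_vector_derivative Im (Digamma (Complex t \<xi>))) (at t)"
    using bounded_linear.has_vector_derivative[OF bounded_linear_Im] by (auto simp: o_def)
  thus ?thesis
    by (simp add: arg_Gamma_def[abs_def] Im_Digamma_def has_real_derivative_iff_has_vector_derivative)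
qed

text \<open>Imaginary part of the partial fraction series of \<open>Digamma\<close>; the terms 1/(n
  + 1) and the Euler constant are real and drop out.\<close>

lemma Im_Digamma_sums:
  assumes "\<xi> \<noteq> 0"
  shows "(\<lambda>n. \<xi> / ((t + real n)\<^sup>2 + \<xi>\<^sup>2)) sums Im_Digamma \<xi> t"
proof -
  let ?z = "Complex t \<xi>"
  have "?z \<noteq> 0" using assms by (simp add: complex_eq_iff)
  hence "(\<lambda>n. inverse (of_nat (Suc n)) - inverse (?z + of_nat n)) sums (Digamma ?z + euler_mascheroni)"
    using summable_sums[OF summable_Digamma] by (simp add: Digamma_def)
  hence "(\<lambda>n. Im (inverse (of_nat (Suc n)) - inverse (?z + of_nat n))) sums
           Im (Digamma ?z + euler_mascheroni)"
    by (rule sums_Im)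
  moreover have "Im (inverse (of_nat (Suc n)) - inverse (?z + of_nat n)) =
                   \<xi> / ((t + real n)\<^sup>2 + \<xi>\<^sup>2)" for n
  proof -
    have "Im (inverse (complex_of_real (real (Suc n)))) = 0"
      by (simp only: of_real_inverse[symmetric] Im_complex_of_real)
    thus ?thesis by simp
  qed
  moreover have "Im (euler_mascheroni :: complex) = 0"
    by (metis Im_complex_of_real of_real_euler_mascheroni)
  ultimately show ?thesis by (simp add: Im_Digamma_def)
qed

lemma Im_Digamma_plus1:
  assumes "\<xi> \<noteq> 0"
  shows "Im_Digamma \<xi> t = \<xi> / (t\<^sup>2 + \<xi>\<^sup>2) + Im_Digamma \<xi> (t + 1)"
proof -
  have "(\<lambda>n. \<xi> / ((t + real (Suc n))\<^sup>2 + \<xi>\<^sup>2)) sums Im_Digamma \<xi> (t + 1)"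
    using Im_Digamma_sums[OF assms, of "t + 1"] by (simp add: add_ac)
  from sums_Suc[OF this] Im_Digamma_sums[OF assms, of t] show ?thesis
    by (simp add: sums_iff)
qed

text \<open>Termwise comparison of the series: from a nonnegative s to a larger t every square grows
  strictly.\<close>

lemma Im_Digamma_strict_antimono:
  assumes "0 < \<xi>" "0 \<le> s" "s < t"
  shows "Im_Digamma \<xi> t < Im_Digamma \<xi> s"
proof -
  have "(s + real n)\<^sup>2 < (t + real n)\<^sup>2" for n
    using assms by (intro power_strict_mono) auto
  hence less: "\<xi> / ((t + real n)\<^sup>2 + \<xi>\<^sup>2) < \<xi> / ((s + real n)\<^sup>2 + \<xi>\<^sup>2)" for n
    using assms by (intro divide_strict_left_mono) (auto simp: add_nonneg_pos)
  have "(\<lambda>n. \<xi> / ((s + real n)\<^sup>2 + \<xi>\<^sup>2) - \<xi> / ((t + real n)\<^sup>2 + \<xi>\<^sup>2)) sums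
          (Im_Digamma \<xi> s - Im_Digamma \<xi> t)"
    using assms by (intro sums_diff Im_Digamma_sums) auto
  moreover from this have "0 < (\<Sum>n. \<xi> / ((s + real n)\<^sup>2 + \<xi>\<^sup>2) - \<xi> / ((t + real n)\<^sup>2 + \<xi>\<^sup>2))"
    using less by (intro suminf_pos) (auto simp: sums_iff)
  ultimately show ?thesis by (simp add: sums_iff)
qed

lemma Gamma_Complex_rcis:
  assumes "\<xi> \<noteq> 0"
  obtains r where "0 < r" "Gamma (Complex t \<xi>) = rcis r (arg_Gamma \<xi> t)"
proof
  show "Gamma (Complex t \<xi>) = rcis (exp (Re (ln_Gamma (Complex t \<xi>)))) (arg_Gamma \<xi> t)"
    using Complex_not_nonpos_Ints[OF assms]
    by (simp add: Gamma_complex_altdef arg_Gamma_def rcis_def exp_eq_polar)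
qed simp

text \<open>Reflection formula with z = \<open>Complex t \<xi>\<close>: \<open>Gamma (1 - z)\<close>
  is the conjugate of \<open>Gamma (Complex (1 - t) \<xi>)\<close>, so that argument enters with the
  opposite sign.\<close>

lemma sin_pi_Complex_rcis:
  assumes "\<xi> \<noteq> 0"
  obtains r where "0 < r"
    "sin (of_real pi * Complex t \<xi>) = rcis r (arg_Gamma \<xi> (1 - t) - arg_Gamma \<xi> t)"
proof -
  obtain r where r: "0 < r" "Gamma (Complex t \<xi>) = rcis r (arg_Gamma \<xi> t)"
    using Gamma_Complex_rcis[OF assms] .
  obtain q where q: "0 < q" "Gamma (Complex (1 - t) \<xi>) = rcis q (arg_Gamma \<xi> (1 - t))"
    using Gamma_Complex_rcis[OF assms] .
  have cnj: "cnj (Complex (1 - t) \<xi>) = 1 - Complex t \<xi>"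
    by (simp add: complex_eq_iff)
  have "Gamma (1 - Complex t \<xi>) = cnj (rcis q (arg_Gamma \<xi> (1 - t)))"
    by (simp add: cnj[symmetric] cnj_Gamma[symmetric] q)
  hence q': "Gamma (1 - Complex t \<xi>) = rcis q (- arg_Gamma \<xi> (1 - t))"
    by (simp add: rcis_def cis_cnj)
  have "sin (of_real pi * Complex t \<xi>) = of_real pi / (Gamma (Complex t \<xi>) * Gamma (1 - Complex t \<xi>))"
    by (simp add: Gamma_reflection_complex)
  also have "\<dots> = rcis pi 0 / rcis (r * q) (arg_Gamma \<xi> t - arg_Gamma \<xi> (1 - t))"
    by (simp add: r q' rcis_mult)
  also have "\<dots> = rcis (pi / (r * q)) (arg_Gamma \<xi> (1 - t) - arg_Gamma \<xi> t)"
    by (subst rcis_divide) simp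
  finally have "sin (of_real pi * Complex t \<xi>) =
    rcis (pi / (r * q)) (arg_Gamma \<xi> (1 - t) - arg_Gamma \<xi> t)" .
  with r(1) q(1) show ?thesis by (intro that) simp_all
qed

section \<open>The quotients T_s and T_B\<close>

text \<open>The identity sin (pi - w) = sin w brings both sines into the form treated by
  \<open>sin_pi_Complex_rcis\<close>.\<close>

lemma T_s_altdef:
  "T_s \<alpha> \<tau> \<xi> = sin (of_real pi * Complex (\<tau> - \<alpha>) \<xi>) / sin (of_real pi * Complex (\<tau> - 2 * \<alpha>) \<xi>)"
proof -
  have "sin (of_real pi * (of_real (1 - t) - \<i> * of_real \<xi>)) = sin (of_real pi * Complex t \<xi>)" for t
  proof -
    have "of_real pi * (of_real (1 - t) - \<i> * of_real \<xi>) = of_real pi - of_real pi * Complex t \<xi>"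
      by (simp add: Complex_eq algebra_simps)
    thus ?thesis by (simp add: sin_diff)
  qed
  from this[of "\<tau> - \<alpha>"] this[of "\<tau> - 2 * \<alpha>"] show ?thesis
    unfolding T_s_def by (simp add: algebra_simps)
qed

lemma T_B_altdef:
  "T_B \<alpha> \<tau> \<xi> = of_real (sin (pi * \<alpha>) / pi * Gamma (2 * \<alpha>)) *
     (Gamma (Complex (1 + \<tau> - 2 * \<alpha>) \<xi>) / Gamma (Complex (1 + \<tau>) \<xi>))"
proof -
  have "of_real (\<tau> - 2 * \<alpha> + 1) + \<i> * of_real \<xi> = Complex (1 + \<tau> - 2 * \<alpha>) \<xi>"
       "Complex (1 + \<tau> - 2 * \<alpha>) \<xi> + of_real (2 * \<alpha>) = Complex (1 + \<tau>) \<xi>"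
    by (simp_all add: complex_eq_iff)
  thus ?thesis
    unfolding T_B_def Beta_def by (simp add: Gamma_complex_of_real flip: of_real_mult)
qed

text \<open>Together with \<open>T_B_cnj\<close> this reduces negative \<xi> to positive
  \<xi>.\<close>

lemma T_s_cnj: "T_s \<alpha> \<tau> (- \<xi>) = cnj (T_s \<alpha> \<tau> \<xi>)"
proof -
  have "sin (cnj z) = cnj (sin z)" for z :: complex
    by (simp add: cnj_sin)
  moreover have "of_real pi * Complex t (- \<xi>) = cnj (of_real pi * Complex t \<xi>)" for t
    by (simp add: complex_eq_iff)
  ultimately show ?thesis by (simp only: T_s_altdef complex_cnj_divide)
qed

lemma T_B_cnj: "T_B \<alpha> \<tau> (- \<xi>) = cnj (T_B \<alpha> \<tau> \<xi>)"
proof -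
  have "Complex t (- \<xi>) = cnj (Complex t \<xi>)" for t
    by (simp add: complex_eq_iff)
  thus ?thesis
    by (simp only: T_B_altdef complex_cnj_mult complex_cnj_divide complex_cnj_complex_of_real cnj_Gamma)
qed

section \<open>Comparison of arguments\<close>

text \<open>
  Continuous branches of the arguments of \<open>T_s\<close> and \<open>T_B\<close>, parametrised by \<open>a = \<alpha>\<close> with
  \<open>u = \<tau> - \<alpha>\<close> held fixed; both vanish at \<open>a = 0\<close>.
\<close>

definition arg_s :: "real \<Rightarrow> real \<Rightarrow> real \<Rightarrow> real" where
  "arg_s \<xi> u a = (arg_Gamma \<xi> (1 - u) - arg_Gamma \<xi> u) - (arg_Gamma \<xi> (1 - (u - a)) - arg_Gamma \<xi> (u - a))"

definition arg_B :: "real \<Rightarrow> real \<Rightarrow> real \<Rightarrow> real" where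
  "arg_B \<xi> u a = arg_Gamma \<xi> (1 + u - a) - arg_Gamma \<xi> (1 + u + a)"

lemma T_s_rcis:
  assumes "\<xi> \<noteq> 0"
  obtains r where "0 < r" "T_s \<alpha> \<tau> \<xi> = rcis r (arg_s \<xi> (\<tau> - \<alpha>) \<alpha>)"
proof -
  obtain r where r: "0 < r" "sin (of_real pi * Complex (\<tau> - \<alpha>) \<xi>) =
      rcis r (arg_Gamma \<xi> (1 - (\<tau> - \<alpha>)) - arg_Gamma \<xi> (\<tau> - \<alpha>))"
    using sin_pi_Complex_rcis[OF assms] .
  obtain q where q: "0 < q" "sin (of_real pi * Complex (\<tau> - 2 * \<alpha>) \<xi>) =
      rcis q (arg_Gamma \<xi> (1 - (\<tau> - 2 * \<alpha>)) - arg_Gamma \<xi> (\<tau> - 2 * \<alpha>))"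
    using sin_pi_Complex_rcis[OF assms] .
  have "\<tau> - \<alpha> - \<alpha> = \<tau> - 2 * \<alpha>" by simp
  hence "T_s \<alpha> \<tau> \<xi> = rcis (r / q) (arg_s \<xi> (\<tau> - \<alpha>) \<alpha>)"
    unfolding T_s_altdef r q rcis_divide arg_s_def by presburger
  with r(1) q(1) show ?thesis by (intro that) simp_all
qed

lemma T_B_rcis:
  assumes "\<xi> \<noteq> 0" "0 < \<alpha>" "\<alpha> < 1"
  obtains r where "0 < r" "T_B \<alpha> \<tau> \<xi> = rcis r (arg_B \<xi> (\<tau> - \<alpha>) \<alpha>)"
proof -
  obtain r where r: "0 < r" "Gamma (Complex (1 + \<tau> - 2 * \<alpha>) \<xi>) = rcis r (arg_Gamma \<xi> (1 + \<tau> - 2 * \<alpha>))"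
    using Gamma_Complex_rcis[OF assms(1)] .
  obtain q where q: "0 < q" "Gamma (Complex (1 + \<tau>) \<xi>) = rcis q (arg_Gamma \<xi> (1 + \<tau>))"
    using Gamma_Complex_rcis[OF assms(1)] .
  define c where "c = sin (pi * \<alpha>) / pi * Gamma (2 * \<alpha>)"
  have "0 < c"
    unfolding c_def using assms by (intro mult_pos_pos divide_pos_pos sin_gt_zero) auto
  have "1 + (\<tau> - \<alpha>) - \<alpha> = 1 + \<tau> - 2 * \<alpha>" "1 + (\<tau> - \<alpha>) + \<alpha> = 1 + \<tau>"
    by simp_all
  hence "T_B \<alpha> \<tau> \<xi> = rcis (c * (r / q)) (arg_B \<xi> (\<tau> - \<alpha>) \<alpha>)"
    unfolding T_B_altdef r q rcis_divide arg_B_def c_def[symmetric] by (simp add: rcis_def)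
  with r(1) q(1) \<open>0 < c\<close> show ?thesis by (intro that) simp_all
qed

text \<open>With A and B the two sines, Im (A / B) has the sign of Im A Re B - Re A Im B, which
  equals -cosh (pi \<xi>) sinh (pi \<xi>) sin (pi \<alpha>) for every \<tau>.\<close>

lemma Im_T_s_neg:
  assumes "0 < \<xi>" "0 < \<alpha>" "\<alpha> < 1"
  shows "Im (T_s \<alpha> \<tau> \<xi>) < 0"
proof -
  define y where "y = pi * \<xi>"
  have "0 < y" using assms by (simp add: y_def)
  define A where "A = sin (of_real pi * Complex (\<tau> - \<alpha>) \<xi>)"
  define B where "B = sin (of_real pi * Complex (\<tau> - 2 * \<alpha>) \<xi>)"
  define p where "p = pi * (\<tau> - \<alpha>)"
  define q where "q = pi * (\<tau> - 2 * \<alpha>)"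
  define c where "c = (exp y + exp (- y)) / 2"
  define s where "s = (exp y - exp (- y)) / 2"
  have "0 < c" "0 < s" using \<open>0 < y\<close> by (auto simp: c_def s_def add_pos_pos)
  have A: "Re A = sin p * c" "Im A = cos p * s" and B: "Re B = sin q * c" "Im B = cos q * s"
    by (simp_all add: A_def B_def p_def q_def c_def s_def y_def Re_sin Im_sin)
  have "Im A * Re B - Re A * Im B = - (c * s * sin (p - q))"
    unfolding A B by (simp add: sin_diff algebra_simps)
  moreover have "p - q = pi * \<alpha>" by (simp add: p_def q_def algebra_simps)
  moreover have "0 < sin (pi * \<alpha>)" using assms by (intro sin_gt_zero) auto
  ultimately have neg: "Im A * Re B - Re A * Im B < 0"
    using \<open>0 < c\<close> \<open>0 < s\<close> by simp
  \<comment> \<open>If B were 0, the expression just shown to be negative would vanish.\<close>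
  hence "(Re B)\<^sup>2 + (Im B)\<^sup>2 > 0"
    by (metis complex_neq_0 diff_self mult_zero_right order_less_irrefl zero_complex.sel)
  with neg have "Im (A / B) < 0"
    by (simp add: Im_divide divide_neg_pos)
  thus ?thesis by (simp add: T_s_altdef A_def B_def)
qed

text \<open>Continuity in a: the branch starts at 0, and reaching -pi would make some
  \<open>T_s\<close> real, against \<open>Im_T_s_neg\<close>.\<close>

lemma arg_s_gt_minus_pi:
  assumes "0 < \<xi>" "0 < \<alpha>" "\<alpha> < 1"
  shows "- pi < arg_s \<xi> u \<alpha>"
proof (rule ccontr)
  assume "\<not> - pi < arg_s \<xi> u \<alpha>"
  moreover have "arg_s \<xi> u 0 = 0" by (simp add: arg_s_def)
  moreover have "continuous_on {0..\<alpha>} (arg_s \<xi> u)"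
    unfolding arg_s_def[abs_def] using assms
    by (intro continuous_intros continuous_on_compose2[OF DERIV_continuous_on[OF
          has_field_derivative_at_within[OF has_field_derivative_arg_Gamma]]]) auto
  ultimately obtain a where a: "0 \<le> a" "a \<le> \<alpha>" "arg_s \<xi> u a = - pi"
    using IVT2'[of "arg_s \<xi> u" \<alpha> "- pi" 0] assms by auto
  hence "a \<noteq> 0" by (auto simp: arg_s_def)
  \<comment> \<open>Here \<tau> = u + a moves with a, which keeps \<tau> - a = u fixed along the
    path.\<close>
  obtain r where "T_s a (u + a) \<xi> = rcis r (arg_s \<xi> u a)"
    using T_s_rcis[of \<xi> a "u + a"] assms by auto
  hence "Im (T_s a (u + a) \<xi>) = 0" by (simp add: a)
  moreover have "Im (T_s a (u + a) \<xi>) < 0"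
    using a \<open>a \<noteq> 0\<close> assms by (intro Im_T_s_neg) auto
  ultimately show False by simp
qed

text \<open>\<open>arg_Gamma\<close> increases in t, its derivative being a series of positive
  terms.\<close>

lemma arg_B_neg:
  assumes "0 < \<xi>" "0 < a"
  shows "arg_B \<xi> u a < 0"
proof -
  have pos: "0 < Im_Digamma \<xi> t" for t
  proof -
    have "0 < (\<Sum>n. \<xi> / ((t + real n)\<^sup>2 + \<xi>\<^sup>2))"
      using assms Im_Digamma_sums[of \<xi> t]
      by (intro suminf_pos) (auto simp: sums_iff add_nonneg_pos)
    thus ?thesis using assms Im_Digamma_sums[of \<xi> t] by (simp add: sums_iff)
  qed
  have "arg_Gamma \<xi> (1 + u - a) < arg_Gamma \<xi> (1 + u + a)"
    using assms pos has_field_derivative_arg_Gamma[of \<xi>]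
    by (intro DERIV_pos_imp_increasing[of _ _ "arg_Gamma \<xi>"]) (simp, metis less_irrefl)
  thus ?thesis by (simp add: arg_B_def)
qed

text \<open>The range of u is the one that u = \<tau> - \<alpha> runs through. If u < 0, then 0 < a
  - u < 1 + u + a because u > -1/2, and monotonicity suffices.\<close>

lemma Im_Digamma_comparison:
  assumes "0 < \<xi>" "0 < a" "- 1/2 < u" "u < 1"
  shows "Im_Digamma \<xi> (1 + u + a) < Im_Digamma \<xi> (a - u)"
proof (cases "u < 0")
  case True
  thus ?thesis using assms by (intro Im_Digamma_strict_antimono) auto
next
  case False
  \<comment> \<open>Now a - u may be negative, outside the range of monotonicity; the comparison is
    made at a - u + 1 > 0, and the recurrence leads back to a - u.\<close>
  have "Im_Digamma \<xi> (1 + u + a) \<le> Im_Digamma \<xi> (a - u + 1)"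
    using False assms Im_Digamma_strict_antimono[of \<xi> "a - u + 1" "1 + u + a"]
    by (cases "u = 0") (auto simp: add_ac)
  also have "\<dots> < Im_Digamma \<xi> (a - u)"
    using assms Im_Digamma_plus1[of \<xi> "a - u"] by (simp add: add_nonneg_pos)
  finally show ?thesis .
qed

lemma arg_s_less_arg_B:
  assumes "0 < \<xi>" "0 < \<alpha>" "- 1/2 < u" "u < 1"
  shows "arg_s \<xi> u \<alpha> < arg_B \<xi> u \<alpha>"
proof -
  define D where "D a = arg_s \<xi> u a - arg_B \<xi> u a" for a
  have "(D has_field_derivative (Im_Digamma \<xi> (1 + u + a) - Im_Digamma \<xi> (a - u))) (at a)" for a
  proof -
    note deriv = has_field_derivative_arg_Gamma[of \<xi>, THEN DERIV_chain2]
    have "(D has_field_derivative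
            (- Im_Digamma \<xi> (1 - (u - a)) - Im_Digamma \<xi> (u - a)
             + Im_Digamma \<xi> (1 + u - a) + Im_Digamma \<xi> (1 + u + a))) (at a)"
      unfolding D_def arg_s_def arg_B_def using assms
      by (auto intro!: derivative_eq_intros deriv)
    \<comment> \<open>The recurrences at u - a and a - u split off the same fraction, which cancels
      and leaves two of the four terms.\<close>
    moreover have "Im_Digamma \<xi> (u - a) = \<xi> / ((u - a)\<^sup>2 + \<xi>\<^sup>2) + Im_Digamma \<xi> (1 + u - a)"
      using Im_Digamma_plus1[of \<xi> "u - a"] assms by (simp add: algebra_simps)
    moreover have "Im_Digamma \<xi> (a - u) = \<xi> / ((u - a)\<^sup>2 + \<xi>\<^sup>2) + Im_Digamma \<xi> (1 - (u - a))"
      using Im_Digamma_plus1[of \<xi> "a - u"] assms by (simp add: algebra_simps power2_commute)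
    ultimately show ?thesis by (simp add: algebra_simps)
  qed
  moreover from this have "continuous_on {0..\<alpha>} D"
    by (meson DERIV_isCont continuous_at_imp_continuous_on)
  ultimately have "D \<alpha> < D 0"
    using assms Im_Digamma_comparison[of \<xi> _ u] DERIV_neg_imp_decreasing_open[of 0 \<alpha> D]
    by (metis diff_less_0_iff_less)
  moreover have "D 0 = 0" by (simp add: D_def arg_s_def arg_B_def)
  ultimately show ?thesis by (simp add: D_def)
qed

text \<open>Both continuous branches lie strictly between -pi and 0, hence coincide with the
  principal arguments.\<close>

lemma Arg_T_s_less_Arg_T_B:
  assumes "0 < \<alpha>" "\<alpha> < 1/2" "0 < \<tau>" "\<tau> < 1" "0 < \<xi>"
  shows "Arg (T_s \<alpha> \<tau> \<xi>) < Arg (T_B \<alpha> \<tau> \<xi>)"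
proof -
  let ?u = "\<tau> - \<alpha>"
  obtain r where r: "0 < r" "T_s \<alpha> \<tau> \<xi> = rcis r (arg_s \<xi> ?u \<alpha>)"
    using T_s_rcis[of \<xi> \<alpha> \<tau>] assms by auto
  obtain q where q: "0 < q" "T_B \<alpha> \<tau> \<xi> = rcis q (arg_B \<xi> ?u \<alpha>)"
    using T_B_rcis[of \<xi> \<alpha> \<tau>] assms by auto
  have ineqs: "- pi < arg_s \<xi> ?u \<alpha>" "arg_s \<xi> ?u \<alpha> < arg_B \<xi> ?u \<alpha>" "arg_B \<xi> ?u \<alpha> < 0"
    using assms by (auto intro!: arg_s_gt_minus_pi arg_s_less_arg_B arg_B_neg)
  have "arg_s \<xi> ?u \<alpha> \<in> {- pi<..pi}" "arg_B \<xi> ?u \<alpha> \<in> {- pi<..pi}"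
    using ineqs pi_gt_zero by auto
  from Arg_unique'[OF r(1) this(1) r(2)] Arg_unique'[OF q(1) this(2) q(2)] ineqs show ?thesis
    by simp
qed


section \<open>Comparison of moduli\<close>

text \<open>The quotient of the modulus of \<open>Gamma (Complex x \<xi>)\<close> by
  \<open>Gamma x\<close> is the product of (x + k) / cmod (x + k + i \<xi>) over k, and each factor
  grows with x. This is shown for the partial products, then passed to the limit.\<close>

lemma norm_Gamma_ratio_le:
  fixes x b \<xi> :: real
  assumes "0 < x" "0 \<le> b"
  shows "norm (Gamma (Complex x \<xi>)) * Gamma (x + b) \<le> norm (Gamma (Complex (x + b) \<xi>)) * Gamma x"
proof (rule LIMSEQ_le)
  show "(\<lambda>n. norm (Gamma_series (Complex x \<xi>) n) * Gamma_series (x + b) n)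
          \<longlonglongrightarrow> norm (Gamma (Complex x \<xi>)) * Gamma (x + b)"
    by (intro tendsto_intros)
  show "(\<lambda>n. norm (Gamma_series (Complex (x + b) \<xi>) n) * Gamma_series x n)
          \<longlonglongrightarrow> norm (Gamma (Complex (x + b) \<xi>)) * Gamma x"
    by (intro tendsto_intros)
  have "norm (Gamma_series (Complex x \<xi>) n) * Gamma_series (x + b) n
          \<le> norm (Gamma_series (Complex (x + b) \<xi>) n) * Gamma_series x n" for n
  proof -
    have norm_series: "norm (Gamma_series (Complex y \<xi>) n) =
        fact n * exp (y * ln (real n)) / (\<Prod>k=0..n. norm (Complex (y + real k) \<xi>))" for y
    proof -
      have "Complex y \<xi> + of_nat k = Complex (y + real k) \<xi>" for k
        by (simp add: complex_eq_iff)
      thus ?thesis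
        by (simp add: Gamma_series_def norm_divide norm_mult pochhammer_Suc_prod prod_norm[symmetric])
    qed
    have real_series: "Gamma_series y n = fact n * exp (y * ln (real n)) / (\<Prod>k=0..n. y + real k)"
      for y :: real
      by (simp add: Gamma_series_def pochhammer_Suc_prod)
    have pos: "0 < norm (Complex (y + real k) \<xi>)" "0 < y + real k" if "0 < y" for y k
      using that by (auto simp: complex_eq_iff)
    \<comment> \<open>After squaring, the common product of squares cancels and only the terms with
      \<open>\<xi>\<^sup>2\<close> remain.\<close>
    have "norm (Complex (x + b + real k) \<xi>) * (x + real k)
            \<le> norm (Complex (x + real k) \<xi>) * (x + b + real k)" for k
    proof (rule power2_le_imp_le)
      have "\<xi>\<^sup>2 * (x + real k)\<^sup>2 \<le> \<xi>\<^sup>2 * (x + b + real k)\<^sup>2"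
        using assms by (intro mult_left_mono power_mono) auto
      thus "(norm (Complex (x + b + real k) \<xi>) * (x + real k))\<^sup>2
              \<le> (norm (Complex (x + real k) \<xi>) * (x + b + real k))\<^sup>2"
        by (simp add: power_mult_distrib cmod_power2) (simp add: algebra_simps)
    qed (use assms in auto)
    hence "(\<Prod>k=0..n. norm (Complex (x + b + real k) \<xi>) * (x + real k))
            \<le> (\<Prod>k=0..n. norm (Complex (x + real k) \<xi>) * (x + b + real k))"
      using assms by (intro prod_mono) auto
    moreover have "0 < (\<Prod>k=0..n. norm (Complex (y + real k) \<xi>))" "0 < (\<Prod>k=0..n. y + real k)"
      if "0 < y" for y using pos[OF that] by (auto intro!: prod_pos)
    ultimately show ?thesis
      using assms unfolding norm_series real_series prod.distrib
      by (simp add: divide_simps mult_ac)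
  qed
  thus "\<exists>N. \<forall>n\<ge>N. norm (Gamma_series (Complex x \<xi>) n) * Gamma_series (x + b) n
          \<le> norm (Gamma_series (Complex (x + b) \<xi>) n) * Gamma_series x n"
    by blast
qed

lemma T_B_zero: "T_B \<alpha> \<tau> 0 = of_real (sin (pi * \<alpha>) / pi * Beta (1 + \<tau> - 2 * \<alpha>) (2 * \<alpha>))"
proof -
  have "Complex t 0 = of_real t" for t by (simp add: complex_eq_iff)
  thus ?thesis
    by (simp only: T_B_altdef Beta_def Gamma_complex_of_real flip: of_real_mult of_real_divide) simp
qed

lemma T_s_zero: "T_s \<alpha> \<tau> 0 = of_real (sin (pi * (\<tau> - \<alpha>)) / sin (pi * (\<tau> - 2 * \<alpha>)))"
proof -
  have "of_real pi * Complex t 0 = of_real (pi * t)" for t by (simp add: complex_eq_iff)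
  thus ?thesis by (simp only: T_s_altdef sin_of_real of_real_divide)
qed

text \<open>The bound is the value of \<open>T_B\<close> at \<xi> = 0; the ratio estimate is applied
  with shift 2\<alpha>.\<close>

lemma norm_T_B_le:
  assumes "0 < \<alpha>" "\<alpha> < 1" "2 * \<alpha> < 1 + \<tau>"
  shows "norm (T_B \<alpha> \<tau> \<xi>) \<le> sin (pi * \<alpha>) / pi * Beta (1 + \<tau> - 2 * \<alpha>) (2 * \<alpha>)"
proof -
  let ?x = "1 + \<tau> - 2 * \<alpha>"
  have c: "0 < sin (pi * \<alpha>) / pi * Gamma (2 * \<alpha>)"
    using assms by (intro mult_pos_pos divide_pos_pos sin_gt_zero) auto
  have "Complex (1 + \<tau>) \<xi> \<notin> \<int>\<^sub>\<le>\<^sub>0"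
    using assms by (auto elim!: nonpos_Ints_cases simp: complex_eq_iff)
  hence "0 < norm (Gamma (Complex (1 + \<tau>) \<xi>))" by (simp add: Gamma_eq_zero_iff)
  moreover have "0 < Gamma (1 + \<tau>)" using assms by (intro Gamma_real_pos) auto
  ultimately have "norm (Gamma (Complex ?x \<xi>)) / norm (Gamma (Complex (1 + \<tau>) \<xi>)) \<le> Gamma ?x / Gamma (1 + \<tau>)"
    using norm_Gamma_ratio_le[of ?x "2 * \<alpha>" \<xi>] assms by (simp add: field_simps)
  hence "sin (pi * \<alpha>) / pi * Gamma (2 * \<alpha>) * (norm (Gamma (Complex ?x \<xi>)) / norm (Gamma (Complex (1 + \<tau>) \<xi>)))
           \<le> sin (pi * \<alpha>) / pi * Gamma (2 * \<alpha>) * (Gamma ?x / Gamma (1 + \<tau>))"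
    using c by (intro mult_left_mono) auto
  moreover have "norm (T_B \<alpha> \<tau> \<xi>) = sin (pi * \<alpha>) / pi * Gamma (2 * \<alpha>) *
      (norm (Gamma (Complex ?x \<xi>)) / norm (Gamma (Complex (1 + \<tau>) \<xi>)))"
    unfolding T_B_altdef norm_mult norm_divide norm_of_real abs_of_pos[OF c] by simp
  ultimately show ?thesis by (simp add: Beta_def mult_ac)
qed

text \<open>At integers both sides are 0, by the conventions for poles of \<open>Gamma\<close> and
  for division by zero.\<close>

lemma Gamma_reflection_real: "Gamma x * Gamma (1 - x) = pi / sin (pi * x)" for x :: real
proof -
  have "complex_of_real (Gamma x * Gamma (1 - x)) = of_real (pi / sin (pi * x))"
    using Gamma_reflection_complex[of "of_real x"] Gamma_complex_of_real[of "1 - x"]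
    by (simp add: Gamma_complex_of_real sin_of_real[symmetric])
  thus ?thesis by (simp only: of_real_eq_iff)
qed

lemma sin_pi_div_pi: "sin (pi * x) / pi = 1 / (Gamma x * Gamma (1 - x))" for x :: real
  by (simp add: Gamma_reflection_real)

lemma Gamma_real_plus1: "0 < x \<Longrightarrow> Gamma (1 + x) = x * Gamma x" for x :: real
proof -
  assume "0 < x"
  hence "x \<notin> \<int>\<^sub>\<le>\<^sub>0" by (auto elim!: nonpos_Ints_cases)
  thus ?thesis using Gamma_plus1[of x] by (simp add: add.commute)
qed

text \<open>The left-hand side is \<open>\<Gamma>(1 + 2\<alpha>) / (2 \<Gamma>(1 + \<alpha>)\<^sup>2)\<close>, which increases to its value \<open>2/\<pi>\<close> at \<open>\<alpha> = 1/2\<close>.\<close>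

lemma sin_Beta_le_two_over_pi:
  assumes "0 < \<alpha>" "\<alpha> < 1/2"
  shows "sin (pi * \<alpha>) / pi * Beta (1 - \<alpha>) (2 * \<alpha>) \<le> 2 / pi"
proof -
  define h where "h a = ln_Gamma (1 + 2 * a) - 2 * ln_Gamma (1 + a)" for a :: real
  have pos: "Gamma \<alpha> > 0" "Gamma (1 - \<alpha>) > 0" "Gamma (1 + \<alpha>) > 0" "Gamma (2 * \<alpha>) > 0"
    using assms by (auto intro!: Gamma_real_pos)
  have G1: "Gamma (1 + \<alpha>) = \<alpha> * Gamma \<alpha>" "Gamma (1 + 2 * \<alpha>) = 2 * \<alpha> * Gamma (2 * \<alpha>)"
    using Gamma_real_plus1[of \<alpha>] Gamma_real_plus1[of "2 * \<alpha>"] assms by auto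
  \<comment> \<open>By reflection the sine factor is 1 / (Gamma \<alpha> Gamma (1 - \<alpha>)), so
    Gamma (1 - \<alpha>) cancels.\<close>
  have "sin (pi * \<alpha>) / pi * Beta (1 - \<alpha>) (2 * \<alpha>) = Gamma (1 + 2 * \<alpha>) / (2 * (Gamma (1 + \<alpha>))\<^sup>2)"
  proof -
    have "1 - \<alpha> + 2 * \<alpha> = 1 + \<alpha>" by simp
    thus ?thesis
      using pos[THEN less_imp_neq] assms
      by (simp only: sin_pi_div_pi Beta_def G1) (simp add: power2_eq_square)
  qed
  also have "\<dots> = exp (h \<alpha>) / 2"
    using assms by (simp add: h_def exp_diff Gamma_real_pos_exp exp_double[symmetric] mult.commute)
  also have "h \<alpha> \<le> h (1/2)"
  proof (rule DERIV_nonneg_imp_nondecreasing[of \<alpha> "1/2" h])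
    fix a :: real assume a: "\<alpha> \<le> a" "a \<le> 1/2"
    have "(h has_field_derivative (2 * Digamma (1 + 2 * a) - 2 * Digamma (1 + a))) (at a)"
      unfolding h_def using assms a by (auto intro!: derivative_eq_intros)
    moreover have "Digamma (1 + a) \<le> Digamma (1 + 2 * a)"
      using assms a by (intro Digamma_real_mono) auto
    ultimately show "\<exists>y. (h has_real_derivative y) (at a) \<and> 0 \<le> y" by fastforce
  qed (use assms in auto)
  also have "exp (h (1/2)) = 4 / pi"
  proof -
    have "Gamma (3/2 :: real) = 1/2 * sqrt pi"
      using Gamma_real_plus1[of "1/2"] by (simp add: Gamma_one_half_real)
    moreover have "exp (h (1/2)) = Gamma 2 / (Gamma (3/2))\<^sup>2"
      by (simp add: h_def exp_diff Gamma_real_pos_exp exp_double[symmetric] mult.commute)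
    moreover have "Gamma (2 :: real) = 1" using Gamma_real_plus1[of 1] by simp
    ultimately show ?thesis by (simp only:) (simp add: power_mult_distrib power_divide)
  qed
  finally show ?thesis by simp
qed

text \<open>The bound is tanh (pi \<xi>): the modulus of sin (pi (t + i \<xi>)) lies between sinh
  (pi \<xi>) and cosh (pi \<xi>).\<close>

lemma norm_T_s_ge:
  assumes "0 < \<xi>"
  shows "(exp (2 * pi * \<xi>) - 1) / (exp (2 * pi * \<xi>) + 1) \<le> norm (T_s \<alpha> \<tau> \<xi>)"
proof -
  define E where "E = exp (2 * pi * \<xi>)"
  have E: "1 < E" using assms by (simp add: E_def)
  define A where "A = sin (of_real pi * Complex (\<tau> - \<alpha>) \<xi>)"
  define B where "B = sin (of_real pi * Complex (\<tau> - 2 * \<alpha>) \<xi>)"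
  have sq: "(norm (sin (of_real pi * Complex t \<xi>)))\<^sup>2 = (E + inverse E - 2 * cos (2 * (pi * t))) / 4" for t
    by (simp add: norm_sin_squared E_def mult.assoc)
  have A: "(E - 1)\<^sup>2 / (4 * E) \<le> (norm A)\<^sup>2"
  proof -
    have eq: "(E - 1)\<^sup>2 / (4 * E) = (E + inverse E - 2) / 4"
      using E by (simp add: field_simps power2_eq_square)
    show ?thesis using cos_le_one[of "2 * (pi * (\<tau> - \<alpha>))"] unfolding A_def sq eq
      by (intro divide_right_mono) linarith+
  qed
  have B: "(norm B)\<^sup>2 \<le> (E + 1)\<^sup>2 / (4 * E)"
  proof -
    have eq: "(E + 1)\<^sup>2 / (4 * E) = (E + inverse E + 2) / 4"
      using E by (simp add: field_simps power2_eq_square)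
    show ?thesis using cos_ge_minus_one[of "2 * (pi * (\<tau> - 2 * \<alpha>))"] unfolding B_def sq eq
      by (intro divide_right_mono) linarith+
  qed
  have "B \<noteq> 0"
  proof -
    obtain r where "0 < r" "B = rcis r (arg_Gamma \<xi> (1 - (\<tau> - 2 * \<alpha>)) - arg_Gamma \<xi> (\<tau> - 2 * \<alpha>))"
      using sin_pi_Complex_rcis[of \<xi> "\<tau> - 2 * \<alpha>"] assms unfolding B_def by auto
    thus ?thesis by (simp add: rcis_eq_zero_iff)
  qed
  have "((E - 1) * norm B)\<^sup>2 \<le> ((E + 1) * norm A)\<^sup>2"
  proof -
    have "(E - 1)\<^sup>2 * (norm B)\<^sup>2 \<le> (E - 1)\<^sup>2 * ((E + 1)\<^sup>2 / (4 * E))"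
      using B by (intro mult_left_mono) auto
    also have "\<dots> = (E + 1)\<^sup>2 * ((E - 1)\<^sup>2 / (4 * E))" by simp
    also have "\<dots> \<le> (E + 1)\<^sup>2 * (norm A)\<^sup>2"
      using A by (intro mult_left_mono) auto
    finally show ?thesis by (simp add: power_mult_distrib)
  qed
  hence "(E - 1) * norm B \<le> (E + 1) * norm A"
    by (rule power2_le_imp_le) (use E in auto)
  hence "(E - 1) / (E + 1) \<le> norm A / norm B"
    using E \<open>B \<noteq> 0\<close> by (simp add: field_simps)
  thus ?thesis unfolding T_s_altdef norm_divide A_def B_def E_def .
qed

text \<open>This is 2/pi < tanh (pi/4), solved for the exponential.\<close>

lemma exp_half_pi_gt: "(pi + 2) / (pi - 2) < exp (pi / 2)"
proof -
  have "(pi + 2) / (pi - 2) \<le> 46/10"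
    using pi_approx(1) by (simp add: field_simps)
  \<comment> \<open>157/100 is a lower bound of pi/2; after division by 4 the quadratic Taylor bound
    is sharp enough.\<close>
  also have "46/10 < (1 + 157/400 + (157/400)\<^sup>2 / 2 :: real) ^ 4"
    by (simp add: power2_eq_square field_simps)
  also have "\<dots> \<le> exp (157/400) ^ 4"
    by (intro power_mono exp_lower_Taylor_quadratic) auto
  also have "\<dots> = exp (157/100)" by (simp flip: exp_of_nat_mult)
  also have "\<dots> \<le> exp (pi / 2)" using pi_approx(1) by simp
  finally show ?thesis .
qed

lemma norm_T_B_less_norm_T_s:
  assumes "0 < \<alpha>" "\<alpha> < 1/2" "\<alpha> \<le> \<tau>" "1/4 \<le> \<xi>"
  shows "norm (T_B \<alpha> \<tau> \<xi>) < norm (T_s \<alpha> \<tau> \<xi>)"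
proof -
  have "norm (T_B \<alpha> \<tau> \<xi>) \<le> sin (pi * \<alpha>) / pi * Beta (1 + \<tau> - 2 * \<alpha>) (2 * \<alpha>)"
    using assms by (intro norm_T_B_le) auto
  \<comment> \<open>\<open>Beta\<close> decreases in its first argument, so \<tau> = \<alpha> is the
    worst case.\<close>
  also have "\<dots> \<le> sin (pi * \<alpha>) / pi * Beta (1 - \<alpha>) (2 * \<alpha>)"
    using assms by (intro mult_left_mono Beta_real_mono divide_nonneg_pos sin_ge_zero) auto
  also have "\<dots> \<le> 2 / pi"
    using assms by (intro sin_Beta_le_two_over_pi)
  also have "\<dots> < (exp (2 * pi * \<xi>) - 1) / (exp (2 * pi * \<xi>) + 1)"
  proof -
    have "exp (pi / 2) \<le> exp (2 * pi * \<xi>)" using assms by simp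
    hence "(pi + 2) / (pi - 2) < exp (2 * pi * \<xi>)" using exp_half_pi_gt by linarith
    moreover have "2 < pi" using pi_gt3 by simp
    moreover have "0 < exp (2 * pi * \<xi>) + 1" by (simp add: add_pos_pos)
    ultimately show ?thesis by (simp add: field_simps)
  qed
  also have "\<dots> \<le> norm (T_s \<alpha> \<tau> \<xi>)" using assms by (intro norm_T_s_ge) auto
  finally show ?thesis .
qed

section \<open>The real case\<close>

text \<open>Strict concavity of \<open>Digamma\<close> on the positive axis: its derivative
  \<open>Polygamma 1\<close> decreases.\<close>

lemma Digamma_diff_strict_antimono:
  fixes c x y :: real
  assumes "0 < c" "0 < x" "x < y"
  shows "Digamma (y + c) - Digamma y < Digamma (x + c) - Digamma x"
proof (rule DERIV_neg_imp_decreasing[of x y "\<lambda>t. Digamma (t + c) - Digamma t"])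
  fix t assume t: "x \<le> t" "t \<le> y"
  have "((\<lambda>t. Digamma (t + c) - Digamma t) has_field_derivative (Polygamma 1 (t + c) - Polygamma 1 t)) (at t)"
    using assms t by (auto intro!: derivative_eq_intros elim!: nonpos_Ints_cases)
  moreover have "Polygamma 1 (t + c) < Polygamma 1 t"
    using assms t by (intro Polygamma_real_strict_antimono) auto
  ultimately show "\<exists>d. ((\<lambda>t. Digamma (t + c) - Digamma t) has_real_derivative d) (at t) \<and> d < 0"
    by force
qed fact

text \<open>As \<open>\<tau>\<close> tends to \<open>0\<close>, both sides tend to \<open>1 / (2 cos (\<pi> \<alpha>))\<close>; their quotient decreases in \<open>\<tau>\<close>.\<close>

lemma T_s_less_T_B_small:
  fixes \<alpha> \<tau> :: real
  assumes "0 < \<tau>" "\<tau> < \<alpha>" "\<alpha> < 1/2"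
  shows "sin (pi * (\<tau> - \<alpha>)) / sin (pi * (\<tau> - 2 * \<alpha>)) < sin (pi * \<alpha>) / pi * Beta (1 + \<tau> - 2 * \<alpha>) (2 * \<alpha>)"
proof -
  \<comment> \<open>By reflection, f \<tau> - f 0 is the logarithm of the left-hand side divided by
    the right-hand side.\<close>
  define f where "f t = ln_Gamma (2 * \<alpha> - t) + ln_Gamma (1 + t) - ln_Gamma (\<alpha> - t) - ln_Gamma (1 - \<alpha> + t)" for t
  have pos: "0 < Gamma (2 * \<alpha> - \<tau>)" "0 < Gamma (1 + \<tau>)" "0 < Gamma (\<alpha> - \<tau>)" "0 < Gamma (1 - \<alpha> + \<tau>)"
     "0 < Gamma (2 * \<alpha>)" "0 < Gamma \<alpha>" "0 < Gamma (1 - \<alpha>)" "0 < Gamma (1 + \<tau> - 2 * \<alpha>)"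
    using assms by (auto intro!: Gamma_real_pos)
  have "f \<tau> < f 0"
  proof (rule DERIV_neg_imp_decreasing[of 0 \<tau> f])
    fix t assume t: "0 \<le> t" "t \<le> \<tau>"
    have "(f has_field_derivative (- Digamma (2 * \<alpha> - t) + Digamma (1 + t) + Digamma (\<alpha> - t)
             - Digamma (1 - \<alpha> + t))) (at t)"
      unfolding f_def using assms t by (auto intro!: derivative_eq_intros)
    \<comment> \<open>Both sides are increments over length \<alpha>; the left one starts further
      right, since \<alpha> < 1/2.\<close>
    moreover have "Digamma (1 + t) - Digamma (1 - \<alpha> + t) < Digamma (2 * \<alpha> - t) - Digamma (\<alpha> - t)"
      using Digamma_diff_strict_antimono[of \<alpha> "\<alpha> - t" "1 - \<alpha> + t"] assms t by (simp add: algebra_simps)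
    ultimately show "\<exists>y. (f has_real_derivative y) (at t) \<and> y < 0" by force
  qed (use assms in auto)
  hence "exp (f \<tau>) < exp (f 0)" by simp
  hence less: "Gamma (2 * \<alpha> - \<tau>) * Gamma (1 + \<tau>) / (Gamma (\<alpha> - \<tau>) * Gamma (1 - \<alpha> + \<tau>))
                < Gamma (2 * \<alpha>) / (Gamma \<alpha> * Gamma (1 - \<alpha>))"
    using assms by (simp add: f_def exp_diff exp_add flip: Gamma_real_pos_exp)
  have "sin (pi * (\<tau> - \<alpha>)) / sin (pi * (\<tau> - 2 * \<alpha>)) = (sin (pi * (\<alpha> - \<tau>)) / pi) / (sin (pi * (2 * \<alpha> - \<tau>)) / pi)"
    using sin_minus[of "pi * (\<alpha> - \<tau>)"] sin_minus[of "pi * (2 * \<alpha> - \<tau>)"] by (simp add: algebra_simps)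
  also have "\<dots> = Gamma (2 * \<alpha> - \<tau>) * Gamma (1 + \<tau> - 2 * \<alpha>) / (Gamma (\<alpha> - \<tau>) * Gamma (1 - \<alpha> + \<tau>))"
    unfolding sin_pi_div_pi by (simp add: algebra_simps)
  also have "\<dots> = (Gamma (2 * \<alpha> - \<tau>) * Gamma (1 + \<tau>) / (Gamma (\<alpha> - \<tau>) * Gamma (1 - \<alpha> + \<tau>)))
                   * (Gamma (1 + \<tau> - 2 * \<alpha>) / Gamma (1 + \<tau>))"
    using pos by simp
  also have "\<dots> < Gamma (2 * \<alpha>) / (Gamma \<alpha> * Gamma (1 - \<alpha>)) * (Gamma (1 + \<tau> - 2 * \<alpha>) / Gamma (1 + \<tau>))"
    using less pos by (intro mult_strict_right_mono) auto
  also have "\<dots> = sin (pi * \<alpha>) / pi * Beta (1 + \<tau> - 2 * \<alpha>) (2 * \<alpha>)"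
    unfolding sin_pi_div_pi Beta_def by simp
  finally show ?thesis .
qed

lemma T_B_less_T_s_large:
  fixes \<alpha> \<tau> :: real
  assumes "0 < \<alpha>" "2 * \<alpha> < \<tau>" "\<tau> < 1"
  shows "sin (pi * \<alpha>) / pi * Beta (1 + \<tau> - 2 * \<alpha>) (2 * \<alpha>) < sin (pi * (\<tau> - \<alpha>)) / sin (pi * (\<tau> - 2 * \<alpha>))"
proof -
  have sin_pos: "0 < sin (pi * \<alpha>)" "0 < sin (pi * (\<tau> - 2 * \<alpha>))"
    using assms by (auto intro!: sin_gt_zero)
  have "Beta 1 (2 * \<alpha>) = 1 / (2 * \<alpha>)"
    using Gamma_real_plus1[of "2 * \<alpha>"] assms less_imp_neq[OF Gamma_real_pos[of "2 * \<alpha>"]]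
    by (simp add: Beta_def)
  hence "Beta (1 + \<tau> - 2 * \<alpha>) (2 * \<alpha>) \<le> 1 / (2 * \<alpha>)"
    using Beta_real_mono[of 1 "1 + \<tau> - 2 * \<alpha>" "2 * \<alpha>" "2 * \<alpha>"] assms by simp
  hence "sin (pi * \<alpha>) / pi * Beta (1 + \<tau> - 2 * \<alpha>) (2 * \<alpha>) \<le> sin (pi * \<alpha>) / pi * (1 / (2 * \<alpha>))"
    using sin_pos by (intro mult_left_mono) auto
  also have "\<dots> \<le> 1 / 2"
    using sin_x_le_x[of "pi * \<alpha>"] assms by (simp add: field_simps)
  \<comment> \<open>Since sin (pi \<tau>) > 0, the sum formula gives sin (p - q) < 2 sin p cos q,
    which is at most 2 sin p.\<close>
  also have "1 / 2 < sin (pi * (\<tau> - \<alpha>)) / sin (pi * (\<tau> - 2 * \<alpha>))"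
  proof -
    define p where "p = pi * (\<tau> - \<alpha>)"
    define q where "q = pi * \<alpha>"
    have split: "pi * (\<tau> - 2 * \<alpha>) = p - q" "pi * \<tau> = p + q"
      by (simp_all add: p_def q_def algebra_simps)
    have "0 < sin (pi * \<tau>)" "0 < sin (pi * (\<tau> - \<alpha>))"
      using assms by (auto intro!: sin_gt_zero)
    hence "0 < sin (p + q)" "0 < sin p" unfolding split p_def .
    moreover have "sin (p - q) + sin (p + q) = 2 * sin p * cos q"
      by (simp add: sin_add sin_diff)
    moreover have "sin p * cos q \<le> sin p"
      using \<open>0 < sin p\<close> by (simp add: mult_le_cancel_left1)
    ultimately have "sin (p - q) < 2 * sin p" by linarith
    thus ?thesis using sin_pos(2) unfolding split p_def[symmetric] by (simp add: field_simps)
  qed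
  finally show ?thesis .
qed

lemma T_s_zero_neq_T_B_zero:
  assumes "0 < \<alpha>" "\<alpha> < 1/2" "0 < \<tau>" "\<tau> < 1"
  shows "T_s \<alpha> \<tau> 0 \<noteq> T_B \<alpha> \<tau> 0"
proof -
  consider "\<tau> < \<alpha>" | "\<alpha> \<le> \<tau>" "\<tau> \<le> 2 * \<alpha>" | "2 * \<alpha> < \<tau>" by linarith
  thus ?thesis
  proof cases
    case 1
    with assms T_s_less_T_B_small[of \<tau> \<alpha>] show ?thesis
      unfolding T_s_zero T_B_zero of_real_eq_iff by simp
  next
    case 2
    \<comment> \<open>At \<tau> = 2\<alpha> the denominator of \<open>T_s\<close> vanishes and the
      quotient is 0 by convention, still below the positive \<open>T_B\<close>.\<close>
    have "0 \<le> sin (pi * (\<tau> - \<alpha>))" "0 \<le> sin (pi * (2 * \<alpha> - \<tau>))"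
      using assms 2 by (auto intro!: sin_ge_zero)
    moreover have "sin (pi * (\<tau> - 2 * \<alpha>)) = - sin (pi * (2 * \<alpha> - \<tau>))"
      by (simp add: algebra_simps flip: sin_minus)
    ultimately have "sin (pi * (\<tau> - \<alpha>)) / sin (pi * (\<tau> - 2 * \<alpha>)) \<le> 0"
      by (simp add: divide_nonneg_nonneg)
    also have "0 < sin (pi * \<alpha>) / pi * Beta (1 + \<tau> - 2 * \<alpha>) (2 * \<alpha>)"
      unfolding Beta_def using assms 2
      by (intro mult_pos_pos divide_pos_pos sin_gt_zero Gamma_real_pos) auto
    finally show ?thesis unfolding T_s_zero T_B_zero of_real_eq_iff by simp
  next
    case 3
    with assms T_B_less_T_s_large[of \<alpha> \<tau>] show ?thesis
      unfolding T_s_zero T_B_zero of_real_eq_iff by simp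
  qed
qed

theorem theorem9p3:
  fixes \<alpha> :: real
  assumes "0 < \<alpha>" and "\<alpha> < 1/2"
  shows "(\<forall>\<tau>. 0 < \<tau> \<and> \<tau> < 1 \<longrightarrow> T_s \<alpha> \<tau> 0 \<noteq> T_B \<alpha> \<tau> 0)
       \<and> (\<forall>\<tau> \<xi>. \<xi> \<ge> 1/4 \<and> \<alpha> \<le> \<tau> \<and> \<tau> < 1 \<longrightarrow> cmod (T_s \<alpha> \<tau> \<xi>) > cmod (T_B \<alpha> \<tau> \<xi>))
       \<and> (\<forall>\<tau> \<xi>. 0 < \<xi> \<and> \<xi> < 1/4 \<and> \<alpha> \<le> \<tau> \<and> \<tau> < 1 \<longrightarrow> Arg (T_s \<alpha> \<tau> \<xi>) < Arg (T_B \<alpha> \<tau> \<xi>))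
       \<and> (\<forall>\<tau> \<xi>. 0 < \<xi> \<and> 0 < \<tau> \<and> \<tau> < \<alpha> \<longrightarrow> Arg (T_s \<alpha> \<tau> \<xi>) \<noteq> Arg (T_B \<alpha> \<tau> \<xi>))
       \<and> (\<forall>\<tau> \<xi>. 0 < \<tau> \<and> \<tau> < 1 \<longrightarrow> T_s \<alpha> \<tau> \<xi> \<noteq> T_B \<alpha> \<tau> \<xi>)"
proof (intro conjI allI impI)
  fix \<tau> \<xi> :: real
  note arg_less = Arg_T_s_less_Arg_T_B[OF assms]
  show "T_s \<alpha> \<tau> 0 \<noteq> T_B \<alpha> \<tau> 0" if "0 < \<tau> \<and> \<tau> < 1"
    using that assms by (intro T_s_zero_neq_T_B_zero) auto
  show "cmod (T_s \<alpha> \<tau> \<xi>) > cmod (T_B \<alpha> \<tau> \<xi>)" if "\<xi> \<ge> 1/4 \<and> \<alpha> \<le> \<tau> \<and> \<tau> < 1"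
    using that assms by (intro norm_T_B_less_norm_T_s) auto
  show "Arg (T_s \<alpha> \<tau> \<xi>) < Arg (T_B \<alpha> \<tau> \<xi>)" if "0 < \<xi> \<and> \<xi> < 1/4 \<and> \<alpha> \<le> \<tau> \<and> \<tau> < 1"
    using that assms by (intro arg_less) auto
  show "Arg (T_s \<alpha> \<tau> \<xi>) \<noteq> Arg (T_B \<alpha> \<tau> \<xi>)" if "0 < \<xi> \<and> 0 < \<tau> \<and> \<tau> < \<alpha>"
    using that assms arg_less[of \<tau> \<xi>] by auto
  show "T_s \<alpha> \<tau> \<xi> \<noteq> T_B \<alpha> \<tau> \<xi>" if \<tau>: "0 < \<tau> \<and> \<tau> < 1"
  proof (cases \<xi> "0 :: real" rule: linorder_cases)
    case less
    \<comment> \<open>Distinct arguments at -\<xi> > 0 give distinct values, and conjugation carries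
      this over to \<xi>.\<close>
    hence "T_s \<alpha> \<tau> (- \<xi>) \<noteq> T_B \<alpha> \<tau> (- \<xi>)"
      using arg_less[of \<tau> "- \<xi>"] \<tau> by auto
    thus ?thesis by (simp add: T_s_cnj T_B_cnj)
  next
    case equal
    thus ?thesis using \<tau> assms T_s_zero_neq_T_B_zero by auto
  next
    case greater
    thus ?thesis using arg_less[of \<tau> \<xi>] \<tau> by auto
  qed
qed

end
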